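(* Let $M\ge2$ be an integer. Let $X=(X(t))_{t\in\mathbb{R}}$ be a real, centred, second-order strictly stationary random process, continuous in quadratic mean, with finite cumulants of all orders. Assume that, for every $N\ge1$, the polyspectrum $\gamma_N$ of $X$ belongs to $L^{\infty}(\mathbb{R}^N)$, and that the spectrum $\gamma=\gamma_1$ is supported within $[-\pi,\pi]$. For each natural number $j$ let $n=n(j)\in\{0,1,\ldots,M^j-1\}$ be arbitrary, and let $\mathsf{cum}^{S}_{j,n}[k_1,\ldots,k_N]$ be the cumulant of order $N+1$ of the Shannon $M$-band wavelet packet coefficients of $X$ at node $(j,n)$. If $N>1$, then $$\lim_{j\to+\infty}\mathsf{cum}^{S}_{j,n}[k_1,k_2,\ldots,k_N]=0,$$ uniformly in $(k_1,k_2,\ldots,k_N)\in\mathbb{Z}^N$.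
   Context: Fourier transform: $\mathcal{F}f(\omega)=\int_{\mathbb{R}} f(t)e^{-i\omega t}\,dt$, and similarly on $\mathbb{R}^N$. By strict stationarity the joint cumulant of order $N+1$ of $X(t),X(t+t_1),\ldots,X(t+t_N)$ depends only on $(t_1,\ldots,t_N)$ and is denoted $\mathsf{cum}(t_1,\ldots,t_N)$; the polyspectrum $\gamma_N(\omega_1,\ldots,\omega_N)$ is its Fourier transform (assumed to exist). For $N=1$, $\gamma_1=\gamma$ is the spectrum of $X$, i.e. the Fourier transform of its autocorrelation function. Shannon $M$-band filters: for $m\in\{0,\ldots,M-1\}$, $H^{S}_m(\omega)=\sum_{\ell\in\mathbb{Z}}\mathbf{1}_{\Delta_m}(\omega-2\pi\ell)$ with $\Delta_m=\left[-\frac{(m+1)\pi}{M},-\frac{m\pi}{M}\right]\cup\left[\frac{m\pi}{M},\frac{(m+1)\pi}{M}\right]$. Shannon wavelet packet functions: for $n=\sum_{\ell=1}^{j}m_\ell M^{j-\ell}\in\{0,\ldots,M^j-1\}$ with $m_\ell\in\{0,\ldots,M-1\}$, $W^{S}_{j,n}\in L^2(\mathbb{R})$ has Fourier transform (a.e.) $$\mathcal{F}W^{S}_{j,n}(\omega)=M^{j/2}\Big[\prod_{\ell=1}^{j}H^{S}_{m_\ell}(M^{\ell-1}\omega)\Big]\mathbf{1}_{[-\pi,\pi]}(\omega),$$ and $W^{S}_{j,n,k}(t)=W^{S}_{j,n}(t-M^jk)$ for $k\in\mathbb{Z}$. The coefficients at node $(j,n)$ are $c^{S}_{j,n}[k]=\int_{\mathbb{R}}X(t)W^{S}_{j,n,k}(t)\,dt$,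 $k\in\mathbb{Z}$ (the integrals are assumed to exist). The process $(c^{S}_{j,n}[k])_k$ is strictly stationary, and $\mathsf{cum}^{S}_{j,n}[k_1,\ldots,k_N]$ denotes the joint cumulant of $c^{S}_{j,n}[k],c^{S}_{j,n}[k+k_1],\ldots,c^{S}_{j,n}[k+k_N]$ (independent of $k$). It is given by (standing convention) $$\mathsf{cum}^{S}_{j,n}[k_1,\ldots,k_N]=\frac{1}{(2\pi)^N}\int_{\mathbb{R}^N}e^{-iM^j(k_1\omega_1+\cdots+k_N\omega_N)}\gamma_N(-\omega_1,\ldots,-\omega_N)\,\mathcal{F}W^{S}_{j,n}(-\omega_1-\cdots-\omega_N)\prod_{q=1}^{N}\mathcal{F}W^{S}_{j,n}(\omega_q)\,d\omega_1\cdots d\omega_N .$$ *)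

theory Defs
  imports "HOL-Probability.Probability"
begin

section \<open>Fourier transform on \<open>R\<^sup>N\<close>\<close>

text \<open>
  The dimension \<open>N\<close> is quantified over inside the statement, so \<open>R\<^sup>N\<close> is the product of \<open>N\<close> copies
  of \<^const>\<open>lborel\<close>, and its points are functions on \<open>{1..N}\<close>.
  These are extensional: functions evaluated at points built from others have to restrict them.
\<close>

abbreviation RN :: "nat \<Rightarrow> (nat \<Rightarrow> real) measure" where
  "RN N \<equiv> Pi\<^sub>M {1..N} (\<lambda>_. lborel)"

definition fourier :: "nat \<Rightarrow> ((nat \<Rightarrow> real) \<Rightarrow> complex) \<Rightarrow> (nat \<Rightarrow> real) \<Rightarrow> complex" where
  "fourier N f \<omega> =
     (LINT t|RN N. f t * exp (- \<i> * complex_of_real (\<Sum>q=1..N. \<omega> q * t q)))"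

text \<open>
  \<open>g\<close> is the Fourier transform of \<open>f\<close>, as an almost everywhere class. For integrable \<open>f\<close> this is
  \<^const>\<open>fourier\<close> (see \<open>is_fourier_transform_fourier\<close> below). The functions to be transformed
  here need not be integrable: Shannon wavelet packets are only in \<open>L\<^sup>2\<close>, and so is the
  autocorrelation function of a process with spectrum \<open>1\<close> on \<open>[-\<pi>, \<pi>]\<close>. Hence the usual
  extension by duality, with test functions that are integrable along with their transforms
  (this includes all Schwartz functions). It agrees with Plancherel's transform on \<open>L\<^sup>2\<close>
  and with the transform of tempered distributions for bounded \<open>f\<close> and \<open>g\<close>.
\<close>

definition is_fourier_transform ::
    "nat \<Rightarrow> ((nat \<Rightarrow> real) \<Rightarrow> complex) \<Rightarrow> ((nat \<Rightarrow> real) \<Rightarrow> complex) \<Rightarrow> bool" where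
  "is_fourier_transform N f g \<longleftrightarrow>
     (\<forall>\<phi>. integrable (RN N) \<phi> \<and> integrable (RN N) (fourier N \<phi>) \<longrightarrow>
        integrable (RN N) (\<lambda>t. f t * fourier N \<phi> t) \<and>
        integrable (RN N) (\<lambda>\<omega>. g \<omega> * \<phi> \<omega>) \<and>
        (LINT t|RN N. f t * fourier N \<phi> t) = (LINT \<omega>|RN N. g \<omega> * \<phi> \<omega>))"

definition L_infty :: "nat \<Rightarrow> ((nat \<Rightarrow> real) \<Rightarrow> complex) \<Rightarrow> bool" where
  "L_infty N g \<longleftrightarrow> g \<in> borel_measurable (RN N) \<and> (\<exists>C. AE \<omega> in RN N. norm (g \<omega>) \<le> C)"

lemma sigma_finite_RN: "sigma_finite_measure (RN N)"
proof -
  interpret product_sigma_finite "\<lambda>_::nat. lborel :: real measure"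
    by unfold_locales
  show ?thesis by (rule sigma_finite) simp
qed

lemma is_fourier_transform_fourier:
  assumes f: "integrable (RN N) f"
  shows "is_fourier_transform N f (fourier N f)"
  unfolding is_fourier_transform_def
proof (intro allI impI)
  fix \<phi> assume "integrable (RN N) \<phi> \<and> integrable (RN N) (fourier N \<phi>)"
  then have \<phi>: "integrable (RN N) \<phi>" by auto
  interpret R: sigma_finite_measure "RN N" by (rule sigma_finite_RN)
  interpret RR: pair_sigma_finite "RN N" "RN N" by unfold_locales
  define e where "e = (\<lambda>t \<omega>. exp (- \<i> * complex_of_real (\<Sum>q=1..N. \<omega> q * t q)))"
  have norm_e: "norm (e t \<omega>) = 1" for t \<omega>
    by (simp add: e_def norm_exp_eq_Re del: of_real_sum)
  have [measurable]: "f \<in> borel_measurable (RN N)" "\<phi> \<in> borel_measurable (RN N)"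
    using f \<phi> by auto
  have [measurable]: "(\<lambda>(t, \<omega>). e t \<omega>) \<in> borel_measurable (RN N \<Otimes>\<^sub>M RN N)"
    unfolding e_def by measurable
  have "integrable (RN N \<Otimes>\<^sub>M RN N) (\<lambda>(t, \<omega>). f t * \<phi> \<omega>)"
    using f \<phi>
    by (intro RR.Fubini_integrable) (auto simp: norm_mult intro!: integrable_mult_right)
  then have int: "integrable (RN N \<Otimes>\<^sub>M RN N) (\<lambda>(t, \<omega>). f t * \<phi> \<omega> * e t \<omega>)"
    by (rule Bochner_Integration.integrable_bound) (measurable, simp add: norm_mult norm_e split_beta)
  have F\<phi>: "f t * fourier N \<phi> t = (LINT \<omega>|RN N. f t * \<phi> \<omega> * e t \<omega>)" for t
    unfolding fourier_def e_def mult.assoc by (simp add: mult.commute)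
  have Ff: "fourier N f \<omega> * \<phi> \<omega> = (LINT t|RN N. f t * \<phi> \<omega> * e t \<omega>)" for \<omega>
  proof -
    have "fourier N f \<omega> * \<phi> \<omega> = (LINT t|RN N. (f t * e t \<omega>) * \<phi> \<omega>)"
      unfolding fourier_def e_def by simp
    then show ?thesis by (simp add: mult_ac)
  qed
  show "integrable (RN N) (\<lambda>t. f t * fourier N \<phi> t) \<and>
        integrable (RN N) (\<lambda>\<omega>. fourier N f \<omega> * \<phi> \<omega>) \<and>
        (LINT t|RN N. f t * fourier N \<phi> t) = (LINT \<omega>|RN N. fourier N f \<omega> * \<phi> \<omega>)"
    unfolding F\<phi> Ff using RR.integrable_fst[OF int] RR.integrable_snd[OF int]
      RR.Fubini_integral[OF int] by simp
qed


section \<open>Random processes and cumulants\<close>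

definition strictly_stationary :: "'a measure \<Rightarrow> (real \<Rightarrow> 'a \<Rightarrow> real) \<Rightarrow> bool" where
  "strictly_stationary P X \<longleftrightarrow>
     (\<forall>t. X t \<in> borel_measurable P) \<and>
     (\<forall>I h. finite I \<longrightarrow>
        distr P (Pi\<^sub>M I (\<lambda>_. borel)) (\<lambda>x. \<lambda>t\<in>I. X (t + h) x) =
        distr P (Pi\<^sub>M I (\<lambda>_. borel)) (\<lambda>x. \<lambda>t\<in>I. X t x))"

definition mean_square_dist :: "'a measure \<Rightarrow> ('a \<Rightarrow> real) \<Rightarrow> ('a \<Rightarrow> real) \<Rightarrow> ennreal" where
  "mean_square_dist P U V = (\<integral>\<^sup>+x. ennreal ((U x - V x)\<^sup>2) \<partial>P)"

definition qm_continuous :: "'a measure \<Rightarrow> (real \<Rightarrow> 'a \<Rightarrow> real) \<Rightarrow> bool" where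
  "qm_continuous P X \<longleftrightarrow> (\<forall>t. ((\<lambda>s. mean_square_dist P (X s) (X t)) \<longlongrightarrow> 0) (at t))"

definition joint_cumulant :: "'a measure \<Rightarrow> 'i set \<Rightarrow> ('i \<Rightarrow> 'a \<Rightarrow> real) \<Rightarrow> real" where
  "joint_cumulant P I Y =
     (\<Sum>\<pi> | partition_on I \<pi>.
        (- 1) ^ (card \<pi> - 1) * fact (card \<pi> - 1) * (\<Prod>B\<in>\<pi>. LINT x|P. (\<Prod>i\<in>B. Y i x)))"

text \<open>Joint cumulant of \<open>Y(s), Y(s + \<tau>\<^sub>1), \<dots>, Y(s + \<tau>\<^sub>N)\<close>.\<close>

definition lag_cumulant ::
    "'a measure \<Rightarrow> ('t::plus \<Rightarrow> 'a \<Rightarrow> real) \<Rightarrow> nat \<Rightarrow> 't \<Rightarrow> (nat \<Rightarrow> 't) \<Rightarrow> real" where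
  "lag_cumulant P Y N s \<tau> = joint_cumulant P {0..N} (\<lambda>q. if q = 0 then Y s else Y (s + \<tau> q))"

lemma lag_cumulant_stationary:
  assumes "strictly_stationary P X"
  shows "lag_cumulant P X N s \<tau> = lag_cumulant P X N 0 \<tau>"
proof -
  have [measurable]: "X t \<in> borel_measurable P" for t
    using assms by (auto simp: strictly_stationary_def)
  define u where "u q = (if q = 0 then 0 else \<tau> q)" for q
  have mom: "(LINT x|P. (\<Prod>i\<in>B. X (u i + s) x)) = (LINT x|P. (\<Prod>i\<in>B. X (u i) x))"
    if "finite B" for B
  proof -
    let ?I = "u ` B" and ?F = "\<lambda>y. \<Prod>i\<in>B. y (u i) :: real"
    have F: "?F \<in> borel_measurable (Pi\<^sub>M ?I (\<lambda>_. borel))"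
      by (intro borel_measurable_prod measurable_component_singleton) auto
    have m: "(\<lambda>x. \<lambda>t\<in>?I. X (t + h) x) \<in> measurable P (Pi\<^sub>M ?I (\<lambda>_. borel))" for h
      by (intro measurable_restrict) simp
    have "(LINT x|P. (\<Prod>i\<in>B. X (u i + h) x)) =
        (LINT y|distr P (Pi\<^sub>M ?I (\<lambda>_. borel)) (\<lambda>x. \<lambda>t\<in>?I. X (t + h) x). ?F y)" for h
      by (subst integral_distr[OF m F]) (auto intro!: Bochner_Integration.integral_cong prod.cong)
    note this[of s] this[of 0]
    moreover have "distr P (Pi\<^sub>M ?I (\<lambda>_. borel)) (\<lambda>x. \<lambda>t\<in>?I. X (t + s) x) =
        distr P (Pi\<^sub>M ?I (\<lambda>_. borel)) (\<lambda>x. \<lambda>t\<in>?I. X (t + 0) x)"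
      using assms that by (simp add: strictly_stationary_def)
    ultimately show ?thesis by simp
  qed
  have eq: "lag_cumulant P X N h \<tau> = joint_cumulant P {0..N} (\<lambda>q. X (u q + h))" for h
    unfolding lag_cumulant_def u_def by (intro arg_cong[where f = "joint_cumulant P {0..N}"] ext)
      (simp add: add.commute)
  show ?thesis
    unfolding eq joint_cumulant_def
    by (intro sum.cong refl arg_cong2[where f = "(*)"] prod.cong)
      (auto simp: mom dest!: partition_onD1 intro!: mom intro: finite_subset[of _ "{0..N}"])
qed

text \<open>\<open>cum(t\<^sub>1, \<dots>, t\<^sub>N)\<close>; the base time \<open>0\<close> is immaterial by the previous lemma.\<close>

definition process_cumulant ::
    "'a measure \<Rightarrow> (real \<Rightarrow> 'a \<Rightarrow> real) \<Rightarrow> nat \<Rightarrow> (nat \<Rightarrow> real) \<Rightarrow> real" where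
  "process_cumulant P X N \<tau> = lag_cumulant P X N 0 \<tau>"

definition is_polyspectrum ::
    "'a measure \<Rightarrow> (real \<Rightarrow> 'a \<Rightarrow> real) \<Rightarrow> nat \<Rightarrow> ((nat \<Rightarrow> real) \<Rightarrow> complex) \<Rightarrow> bool" where
  "is_polyspectrum P X N g \<longleftrightarrow>
     is_fourier_transform N (\<lambda>t. complex_of_real (process_cumulant P X N t)) g"

text \<open>
  Integrals of random processes are taken in quadratic mean: limits of Riemann sums over \<open>[a, b]\<close>,
  then \<open>a \<rightarrow> -\<infinity>\<close>, \<open>b \<rightarrow> \<infinity>\<close>. Since Shannon wavelet packets decay like \<open>1/t\<close>, the integral
  \<open>\<integral> X(t) W(t) dt\<close> would in general not exist as a pathwise Lebesgue integral.
\<close>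

definition has_qm_integral_on ::
    "'a measure \<Rightarrow> (real \<Rightarrow> 'a \<Rightarrow> real) \<Rightarrow> real \<Rightarrow> real \<Rightarrow> ('a \<Rightarrow> real) \<Rightarrow> bool" where
  "has_qm_integral_on P Y a b Z \<longleftrightarrow>
     Z \<in> borel_measurable P \<and>
     (\<forall>\<epsilon>>0. \<exists>\<delta>>0. \<forall>p. p tagged_division_of {a..b} \<and> (\<lambda>x. ball x \<delta>) fine p \<longrightarrow>
        mean_square_dist P (\<lambda>x. \<Sum>(t, K)\<in>p. measure lborel K * Y t x) Z < \<epsilon>)"

definition has_qm_integral ::
    "'a measure \<Rightarrow> (real \<Rightarrow> 'a \<Rightarrow> real) \<Rightarrow> ('a \<Rightarrow> real) \<Rightarrow> bool" where
  "has_qm_integral P Y Z \<longleftrightarrow>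
     Z \<in> borel_measurable P \<and>
     (\<exists>S. (\<forall>a b. a < b \<longrightarrow> has_qm_integral_on P Y a b (S a b)) \<and>
          ((\<lambda>(a, b). mean_square_dist P (S a b) Z) \<longlongrightarrow> 0) (at_bot \<times>\<^sub>F at_top))"


section \<open>Shannon wavelet packets\<close>

definition shannon_band :: "nat \<Rightarrow> nat \<Rightarrow> real set" where
  "shannon_band M m =
     {- (real (m + 1) * pi / real M) .. - (real m * pi / real M)} \<union>
     {real m * pi / real M .. real (m + 1) * pi / real M}"

definition shannon_filter :: "nat \<Rightarrow> nat \<Rightarrow> real \<Rightarrow> real" where
  "shannon_filter M m \<omega> =
     (\<Sum>\<^sub>\<infinity>l\<in>(UNIV :: int set). indicator (shannon_band M m) (\<omega> - 2 * pi * real_of_int l))"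

text \<open>The digits \<open>m\<^sub>1, \<dots>, m\<^sub>j\<close> of \<open>n\<close> in base \<open>M\<close>, the most significant one first.\<close>

definition node_digit :: "nat \<Rightarrow> nat \<Rightarrow> nat \<Rightarrow> nat \<Rightarrow> nat" where
  "node_digit M j n l = n div M ^ (j - l) mod M"

lemma node_digit_expansion:
  assumes "M \<ge> 2" "n < M ^ j"
  shows "n = (\<Sum>l=1..j. node_digit M j n l * M ^ (j - l))"
  using assms(2)
proof (induction j arbitrary: n)
  case (Suc j)
  have "n div M < M ^ j"
    using Suc.prems assms(1) by (simp add: less_mult_imp_div_less mult.commute)
  then have IH: "n div M = (\<Sum>l=1..j. node_digit M j (n div M) l * M ^ (j - l))"
    by (rule Suc.IH)
  have "(\<Sum>l=1..Suc j. node_digit M (Suc j) n l * M ^ (Suc j - l)) =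
      (\<Sum>l=1..j. node_digit M (Suc j) n l * M ^ (Suc j - l)) + n mod M"
    by (simp add: node_digit_def)
  also have "(\<Sum>l=1..j. node_digit M (Suc j) n l * M ^ (Suc j - l)) =
      M * (\<Sum>l=1..j. node_digit M j (n div M) l * M ^ (j - l))"
    unfolding sum_distrib_left
    by (intro sum.cong) (auto simp: node_digit_def Suc_diff_le div_mult2_eq mult_ac)
  also have "\<dots> = M * (n div M)" using IH by simp
  finally show ?case by simp
qed simp

lemma node_digit_less: "M \<ge> 2 \<Longrightarrow> node_digit M j n l < M"
  by (simp add: node_digit_def)

definition shannon_packet_hat :: "nat \<Rightarrow> nat \<Rightarrow> nat \<Rightarrow> real \<Rightarrow> real" where
  "shannon_packet_hat M j n \<omega> =
     real M powr (real j / 2) *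
     (\<Prod>l=1..j. shannon_filter M (node_digit M j n l) (real (M ^ (l - 1)) * \<omega>)) *
     indicator {- pi..pi} \<omega>"

definition is_shannon_packet :: "nat \<Rightarrow> nat \<Rightarrow> nat \<Rightarrow> (real \<Rightarrow> real) \<Rightarrow> bool" where
  "is_shannon_packet M j n W \<longleftrightarrow>
     W \<in> borel_measurable lborel \<and> integrable lborel (\<lambda>t. (W t)\<^sup>2) \<and>
     is_fourier_transform 1 (\<lambda>t. complex_of_real (W (t 1)))
       (\<lambda>\<omega>. complex_of_real (shannon_packet_hat M j n (\<omega> 1)))"

text \<open>\<open>c\<close> is the sequence of coefficients \<open>c[k] = \<integral> X(t) W(t - M\<^sup>jk) dt\<close>.\<close>

definition are_packet_coeffs ::
    "'a measure \<Rightarrow> (real \<Rightarrow> 'a \<Rightarrow> real) \<Rightarrow> nat \<Rightarrow> nat \<Rightarrow> (real \<Rightarrow> real) \<Rightarrow> (int \<Rightarrow> 'a \<Rightarrow> real) \<Rightarrow> bool"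
  where
  "are_packet_coeffs P X M j W c \<longleftrightarrow>
     (\<forall>k. has_qm_integral P (\<lambda>t x. X t x * W (t - real (M ^ j) * real_of_int k)) (c k))"

text \<open>
  The spectral expression for the cumulants of the coefficients at node \<open>(j, n)\<close>, in terms of the
  polyspectrum \<open>g\<close> of order \<open>N + 1\<close>.
\<close>

definition shannon_cumulant_integral ::
    "nat \<Rightarrow> nat \<Rightarrow> nat \<Rightarrow> nat \<Rightarrow> ((nat \<Rightarrow> real) \<Rightarrow> complex) \<Rightarrow> (nat \<Rightarrow> int) \<Rightarrow> complex" where
  "shannon_cumulant_integral M j n N g k =
     1 / (2 * complex_of_real pi) ^ N *
     (LINT \<omega>|RN N.
        exp (- \<i> * complex_of_real (real (M ^ j) * (\<Sum>q=1..N. real_of_int (k q) * \<omega> q))) *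
        g (\<lambda>q\<in>{1..N}. - \<omega> q) *
        complex_of_real (shannon_packet_hat M j n (- (\<Sum>q=1..N. \<omega> q))) *
        complex_of_real (\<Prod>q=1..N. shannon_packet_hat M j n (\<omega> q)))"

end

theory Submission
  imports Defs
begin

text \<open>
  A Shannon packet at depth \<open>j\<close> is bounded by \<open>M\<^sup>j\<^sup>/\<^sup>2\<close> in the frequency domain, and its spectrum lives
  on a set of measure \<open>2\<pi>/M\<^sup>j\<close>: integrating the product of filters over a period, each filter
  contributes a factor \<open>1/M\<close>. Hence its transform has \<open>L\<^sup>1\<close> norm at most \<open>2\<pi>M\<^sup>-\<^sup>j\<^sup>/\<^sup>2\<close>. In the cumulant
  integral, bound the polyspectrum and the factor at \<open>-\<omega>\<^sub>1 - \<dots> - \<omega>\<^sub>N\<close> by their essential suprema and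
  the remaining \<open>N\<close> factors by their \<open>L\<^sup>1\<close> norms. This gives \<open>C M\<^sup>j\<^sup>(\<^sup>1\<^sup>-\<^sup>N\<^sup>)\<^sup>/\<^sup>2\<close>, independently of
  the phases and thus of the lags.
\<close>

section \<open>Folding one Shannon filter to a single period\<close>

text \<open>
  The folded filter differs from \<^const>\<open>shannon_filter\<close> only at odd multiples of \<open>\<pi>\<close>, where
  two translates of the closed top band meet and the sum equals \<open>2\<close>. For odd \<open>M\<close> this
  can happen at every level at once, so the bound \<open>M\<^sup>j\<^sup>/\<^sup>2\<close> on the packets fails pointwise.
\<close>

definition folded_filter :: "nat \<Rightarrow> nat \<Rightarrow> real \<Rightarrow> real" where
  "folded_filter M m \<omega> =
     indicator (shannon_band M m) (\<omega> - 2 * pi * real_of_int \<lfloor>(\<omega> + pi) / (2 * pi)\<rfloor>)"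

lemma folded_filter_measurable [measurable]: "folded_filter M m \<in> borel_measurable borel"
proof -
  have [measurable]: "shannon_band M m \<in> sets borel"
    by (simp add: shannon_band_def)
  show ?thesis
    unfolding folded_filter_def by measurable
qed

lemma folded_filter_bounds: "0 \<le> folded_filter M m \<omega>" "folded_filter M m \<omega> \<le> 1"
  by (auto simp: folded_filter_def indicator_def)

lemma folded_filter_periodic:
  "folded_filter M m (\<omega> + 2 * pi * real_of_int i) = folded_filter M m \<omega>"
proof -
  have "(\<omega> + 2 * pi * real_of_int i + pi) / (2 * pi) = (\<omega> + pi) / (2 * pi) + of_int i"
    by (simp add: field_simps)
  then show ?thesis
    unfolding folded_filter_def by (simp add: algebra_simps)
qed

lemma shannon_band_subset:
  assumes "m < M"
  shows "shannon_band M m \<subseteq> {-pi..pi}"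
proof -
  have gen: "{-b..-a} \<union> {a..b} \<subseteq> {-p..p}" if "0 \<le> a" "a \<le> b" "b \<le> p" for a b p :: real
    using that by auto
  have "0 \<le> real m * pi / real M" "real m * pi / real M \<le> real (m + 1) * pi / real M"
    by (auto intro!: divide_right_mono mult_right_mono)
  moreover have "real (m + 1) * pi / real M \<le> pi"
    using assms by (simp add: divide_le_eq mult.commute)
  ultimately show ?thesis
    unfolding shannon_band_def by (rule gen)
qed

lemma folded_filter_centre:
  assumes "-pi < \<omega>" "\<omega> < pi"
  shows "folded_filter M m \<omega> = indicator (shannon_band M m) \<omega>"
proof -
  have "\<lfloor>(\<omega> + pi) / (2 * pi)\<rfloor> = 0"
    using assms by (intro floor_unique) (auto simp: field_simps)
  then show ?thesis by (simp add: folded_filter_def)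
qed

text \<open>The band lies in [-pi, pi], and away from the odd multiples of pi exactly one translate
  of the point by a multiple of 2 pi falls into this interval. The infinite sum thus reduces to the
  single index \<open>l\<^sub>0\<close>.\<close>

lemma shannon_filter_eq_folded:
  assumes "m < M" and \<omega>: "\<omega> \<notin> range (\<lambda>i. pi + 2 * pi * real_of_int i)"
  shows "shannon_filter M m \<omega> = folded_filter M m \<omega>"
proof -
  define l\<^sub>0 where "l\<^sub>0 = \<lfloor>(\<omega> + pi) / (2 * pi)\<rfloor>"
  have "real_of_int l\<^sub>0 \<le> (\<omega> + pi) / (2 * pi)" "(\<omega> + pi) / (2 * pi) < real_of_int l\<^sub>0 + 1"
    unfolding l\<^sub>0_def by linarith+
  then have r: "-pi \<le> \<omega> - 2 * pi * l\<^sub>0" "\<omega> - 2 * pi * l\<^sub>0 < pi"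
    by (simp_all add: field_simps)
  \<comment> \<open>At this endpoint the translate by \<open>l\<^sub>0 - 1\<close> would land on pi
    and could contribute a second term.\<close>
  have "\<omega> - 2 * pi * l\<^sub>0 \<noteq> -pi"
  proof
    assume "\<omega> - 2 * pi * l\<^sub>0 = -pi"
    then have "\<omega> = pi + 2 * pi * real_of_int (l\<^sub>0 - 1)" by (simp add: algebra_simps)
    with \<omega> show False by blast
  qed
  with r have r': "-pi < \<omega> - 2 * pi * l\<^sub>0" by simp
  have out: "\<omega> - 2 * pi * real_of_int l \<notin> {-pi..pi}" if "l \<noteq> l\<^sub>0" for l
  proof (cases "l < l\<^sub>0")
    case True
    then have "real_of_int l \<le> real_of_int l\<^sub>0 - 1" by linarith
    then have "2 * pi * real_of_int l \<le> 2 * pi * (real_of_int l\<^sub>0 - 1)"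
      by (intro mult_left_mono) auto
    then show ?thesis using r' by (auto simp: algebra_simps)
  next
    case False
    then have "real_of_int l\<^sub>0 + 1 \<le> real_of_int l" using that by linarith
    then have "2 * pi * (real_of_int l\<^sub>0 + 1) \<le> 2 * pi * real_of_int l"
      by (intro mult_left_mono) auto
    then show ?thesis using r by (auto simp: algebra_simps)
  qed
  have "shannon_filter M m \<omega> =
      (\<Sum>\<^sub>\<infinity>l\<in>{l\<^sub>0}. indicator (shannon_band M m) (\<omega> - 2 * pi * real_of_int l))"
    unfolding shannon_filter_def
    by (rule infsum_cong_neutral)
      (use out shannon_band_subset[OF assms(1)] in \<open>auto simp: indicator_def simp del: atLeastAtMost_iff\<close>)
  also have "\<dots> = folded_filter M m \<omega>"
    by (simp add: folded_filter_def l\<^sub>0_def)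
  finally show ?thesis .
qed

section \<open>L1 norm of products of filters\<close>

lemma nn_integral_interval_shift:
  fixes f :: "real \<Rightarrow> ennreal"
  assumes [measurable]: "f \<in> borel_measurable borel"
    and per: "\<And>x i. f (x + 2 * pi * real_of_int i) = f x"
  shows "(\<integral>\<^sup>+x. indicator {a + 2 * pi * real_of_int i..b + 2 * pi * real_of_int i} x * f x \<partial>lborel) =
      (\<integral>\<^sup>+x. indicator {a..b} x * f x \<partial>lborel)"
proof -
  have "(\<integral>\<^sup>+x. indicator {a + 2 * pi * real_of_int i..b + 2 * pi * real_of_int i} x * f x \<partial>lborel) =
      (\<integral>\<^sup>+x. indicator {a + 2 * pi * real_of_int i..b + 2 * pi * real_of_int i} (2 * pi * real_of_int i + 1 * x)
        * f (2 * pi * real_of_int i + 1 * x) \<partial>lborel)"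
    by (subst nn_integral_real_affine[where c = 1 and t = "2 * pi * real_of_int i"]) auto
  also have "\<dots> = (\<integral>\<^sup>+x. indicator {a..b} x * f x \<partial>lborel)"
    using per by (intro nn_integral_cong) (auto simp: indicator_def add.commute)
  finally show ?thesis .
qed

lemma nn_integral_interval_scale:
  fixes f :: "real \<Rightarrow> ennreal"
  assumes [measurable]: "f \<in> borel_measurable borel" and c: "c > 0"
  shows "(\<integral>\<^sup>+x. indicator {a / c..b / c} x * f (c * x) \<partial>lborel) =
      ennreal (1 / c) * (\<integral>\<^sup>+x. indicator {a..b} x * f x \<partial>lborel)"
proof -
  have "(\<integral>\<^sup>+x. indicator {a / c..b / c} x * f (c * x) \<partial>lborel) =
      ennreal \<bar>1 / c\<bar> * (\<integral>\<^sup>+x. indicator {a / c..b / c} (0 + 1 / c * x) * f (c * (0 + 1 / c * x)) \<partial>lborel)"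
    using c by (intro nn_integral_real_affine) auto
  also have "\<dots> = ennreal (1 / c) * (\<integral>\<^sup>+x. indicator {a..b} x * f x \<partial>lborel)"
    using c by (intro arg_cong2[where f = "(*)"] nn_integral_cong)
      (auto simp: indicator_def divide_right_mono divide_le_cancel)
  finally show ?thesis .
qed

text \<open>Scaled by \<open>M\<close>, the two intervals of a band cover a full period.\<close>

lemma nn_integral_folded_filter:
  fixes f :: "real \<Rightarrow> ennreal"
  assumes "m < M" and [measurable]: "f \<in> borel_measurable borel"
    and per: "\<And>x i. f (x + 2 * pi * real_of_int i) = f x"
  shows "(\<integral>\<^sup>+x. indicator {-pi..pi} x * (ennreal (folded_filter M m x) * f (real M * x)) \<partial>lborel)
      \<le> ennreal (1 / real M) * (\<integral>\<^sup>+x. indicator {-pi..pi} x * f x \<partial>lborel)"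
proof -
  define J where "J a b = (\<integral>\<^sup>+x. indicator {a..b} x * f x \<partial>lborel)" for a b
  have shift: "J (a + 2 * pi * real_of_int i) (b + 2 * pi * real_of_int i) = J a b" for a b i
    unfolding J_def by (rule nn_integral_interval_shift) (use per in auto)
  let ?a = "real m * pi" and ?b = "real (m + 1) * pi"
  have M: "real M > 0" using assms(1) by simp
  \<comment> \<open>\<open>folded_filter_centre\<close> covers only the open interval, so both
    endpoints are discarded. Pointwise the sum of the two indicators is only an upper bound: the two
    intervals of the band share the point 0 when m = 0.\<close>
  have "AE x in lborel. x \<noteq> pi" "AE x in lborel. x \<noteq> -pi"
    by (auto intro!: AE_lborel_singleton)
  then have "(\<integral>\<^sup>+x. indicator {-pi..pi} x * (ennreal (folded_filter M m x) * f (real M * x)) \<partial>lborel)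
      \<le> (\<integral>\<^sup>+x. indicator {(- ?b) / real M..(- ?a) / real M} x * f (real M * x)
          + indicator {?a / real M..?b / real M} x * f (real M * x) \<partial>lborel)"
    by (intro nn_integral_mono_AE, eventually_elim)
      (auto simp: indicator_def folded_filter_centre shannon_band_def)
  also have "\<dots> = ennreal (1 / real M) * (J (- ?b) (- ?a) + J ?a ?b)"
    unfolding J_def distrib_left
    by (subst nn_integral_add) (measurable, simp only: nn_integral_interval_scale[OF assms(2) M])
  also have "J (- ?b) (- ?a) + J ?a ?b = J (-pi) 0 + J 0 pi"
  \<comment> \<open>For even m, shifting by multiples of 2 pi takes the positive interval to [0, pi]
    and the negative one to [-pi, 0]. For odd m the two halves are swapped.\<close>
  proof (cases "even m")
    case True
    then obtain p where p: "m = 2 * p" by blast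
    have "J ?a ?b = J 0 pi"
      using shift[of 0 "int p" pi] by (simp add: p algebra_simps)
    moreover have "J (- ?b) (- ?a) = J (-pi) 0"
      using shift[of "-pi" "- int p" 0] by (simp add: p algebra_simps)
    ultimately show ?thesis by simp
  next
    case False
    then obtain p where p: "m = 2 * p + 1" using oddE by blast
    have "J ?a ?b = J (-pi) 0"
      using shift[of "-pi" "int p + 1" 0] by (simp add: p algebra_simps)
    have "J (- ?b) (- ?a) =
        J (0 + 2 * pi * real_of_int (- int p - 1)) (pi + 2 * pi * real_of_int (- int p - 1))"
      by (rule arg_cong2[where f = J]) (simp_all add: p algebra_simps)
    then have "J (- ?b) (- ?a) = J 0 pi" unfolding shift .
    with \<open>J ?a ?b = J (-pi) 0\<close> show ?thesis by (simp add: add.commute)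
  qed
  also have "J (-pi) 0 + J 0 pi = J (-pi) pi"
  proof -
    have "J (-pi) 0 + J 0 pi =
        (\<integral>\<^sup>+x. indicator {-pi..0} x * f x + indicator {0..pi} x * f x \<partial>lborel)"
      unfolding J_def by (rule nn_integral_add[symmetric]) auto
    also have "\<dots> = J (-pi) pi"
      unfolding J_def
      by (rule nn_integral_cong_AE)
        (use AE_lborel_singleton[of 0] in \<open>eventually_elim, auto simp: indicator_def\<close>)
    finally show ?thesis .
  qed
  finally show ?thesis by (simp add: J_def)
qed

text \<open>Digits form an arbitrary sequence indexed from 0, so that an induction on the depth can
  drop the first digit by shifting the sequence.\<close>

definition folded_product :: "nat \<Rightarrow> nat \<Rightarrow> (nat \<Rightarrow> nat) \<Rightarrow> real \<Rightarrow> real" where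
  "folded_product M j m \<omega> = (\<Prod>l<j. folded_filter M (m l) (real (M ^ l) * \<omega>))"

lemma folded_product_measurable [measurable]: "folded_product M j m \<in> borel_measurable borel"
  unfolding folded_product_def by measurable

lemma folded_product_bounds: "0 \<le> folded_product M j m \<omega>" "folded_product M j m \<omega> \<le> 1"
  unfolding folded_product_def
  by (auto intro!: prod_nonneg prod_le_1 simp: folded_filter_bounds)

lemma folded_product_periodic:
  "folded_product M j m (\<omega> + 2 * pi * real_of_int i) = folded_product M j m \<omega>"
  unfolding folded_product_def
proof (rule prod.cong[OF refl])
  fix l
  show "folded_filter M (m l) (real (M ^ l) * (\<omega> + 2 * pi * real_of_int i)) =
      folded_filter M (m l) (real (M ^ l) * \<omega>)"
    \<comment> \<open>Since M^l is an integer, i periods of the argument become M^l i periods of the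
      filter.\<close>
    using folded_filter_periodic[of M "m l" "real (M ^ l) * \<omega>" "int (M ^ l) * i"]
    by (simp add: algebra_simps)
qed

text \<open>Splitting off the first factor leaves a periodic function of M \<omega>, the shape to
  which \<open>nn_integral_folded_filter\<close> applies.\<close>

lemma folded_product_Suc:
  "folded_product M (Suc j) m \<omega> =
     folded_filter M (m 0) \<omega> * folded_product M j (\<lambda>l. m (Suc l)) (real M * \<omega>)"
  unfolding folded_product_def by (subst prod.lessThan_Suc_shift) (simp add: mult_ac)

text \<open>Each level gains a factor 1/M, starting from the length 2 pi of the period. The digits
  are generalised in the induction because the tail uses the shifted sequence.\<close>

lemma nn_integral_folded_product:
  assumes "\<And>l. m l < M"
  shows "(\<integral>\<^sup>+x. indicator {-pi..pi} x * ennreal (folded_product M j m x) \<partial>lborel)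
      \<le> ennreal (2 * pi / real M ^ j)"
  using assms
proof (induction j arbitrary: m)
  case 0
  show ?case by (simp add: folded_product_def)
next
  case (Suc j)
  have "(\<integral>\<^sup>+x. indicator {-pi..pi} x * ennreal (folded_product M (Suc j) m x) \<partial>lborel) =
      (\<integral>\<^sup>+x. indicator {-pi..pi} x * (ennreal (folded_filter M (m 0) x) *
        ennreal (folded_product M j (\<lambda>l. m (Suc l)) (real M * x))) \<partial>lborel)"
    by (simp add: folded_product_Suc ennreal_mult folded_filter_bounds folded_product_bounds)
  also have "\<dots> \<le> ennreal (1 / real M) *
      (\<integral>\<^sup>+x. indicator {-pi..pi} x * ennreal (folded_product M j (\<lambda>l. m (Suc l)) x) \<partial>lborel)"
    by (rule nn_integral_folded_filter) (use Suc.prems in \<open>auto simp: folded_product_periodic\<close>)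
  also have "\<dots> \<le> ennreal (1 / real M) * ennreal (2 * pi / real M ^ j)"
    by (intro mult_left_mono Suc.IH) (use Suc.prems in auto)
  also have "\<dots> = ennreal (2 * pi / real M ^ Suc j)"
    by (simp add: ennreal_mult[symmetric])
  finally show ?case .
qed

section \<open>Packets in the frequency domain, up to null sets\<close>

text \<open>A representative of the packet's transform that is bounded by M^(j/2) everywhere, not
  just almost everywhere.\<close>

definition packet_majorant :: "nat \<Rightarrow> nat \<Rightarrow> nat \<Rightarrow> real \<Rightarrow> real" where
  "packet_majorant M j n \<omega> =
     sqrt (real M) ^ j * folded_product M j (\<lambda>l. node_digit M j n (Suc l)) \<omega> * indicator {-pi..pi} \<omega>"

lemma packet_majorant_measurable [measurable]: "packet_majorant M j n \<in> borel_measurable borel"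
  unfolding packet_majorant_def by measurable

lemma packet_majorant_bounds: "0 \<le> packet_majorant M j n \<omega>" "packet_majorant M j n \<omega> \<le> sqrt (real M) ^ j"
  using folded_product_bounds[of M j "\<lambda>l. node_digit M j n (Suc l)" \<omega>]
  by (auto simp: packet_majorant_def indicator_def mult_left_le)

lemma nn_integral_packet_majorant:
  assumes "M \<ge> 2"
  shows "(\<integral>\<^sup>+x. ennreal (packet_majorant M j n x) \<partial>lborel) \<le> ennreal (2 * pi / sqrt (real M) ^ j)"
proof -
  let ?m = "\<lambda>l. node_digit M j n (Suc l)"
  have "(\<integral>\<^sup>+x. ennreal (packet_majorant M j n x) \<partial>lborel) =
     (\<integral>\<^sup>+x. ennreal (sqrt (real M) ^ j) * (indicator {-pi..pi} x * ennreal (folded_product M j ?m x)) \<partial>lborel)"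
    by (intro nn_integral_cong)
      (auto simp: packet_majorant_def indicator_def ennreal_mult folded_product_bounds)
  also have "\<dots> \<le> ennreal (sqrt (real M) ^ j) * ennreal (2 * pi / real M ^ j)"
    by (subst nn_integral_cmult)
      (auto intro!: mult_left_mono nn_integral_folded_product node_digit_less assms)
  also have "\<dots> = ennreal (2 * pi / sqrt (real M) ^ j)"
  proof -
    have "real M ^ j = sqrt (real M) ^ j * sqrt (real M) ^ j"
      by (simp add: power_mult_distrib[symmetric])
    then show ?thesis using assms by (simp add: ennreal_mult[symmetric])
  qed
  finally show ?thesis .
qed

text \<open>The points at which some factor of the packet hits an odd multiple of \<open>\<pi>\<close>.\<close>

definition edge_points :: "nat \<Rightarrow> real set" where
  "edge_points M = (\<Union>l. range (\<lambda>i. (pi + 2 * pi * real_of_int i) / real (M ^ l)))"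

lemma countable_edge_points: "countable (edge_points M)"
  unfolding edge_points_def by auto

text \<open>Off \<open>edge_points\<close> every filter equals its folded version. That set collects
  the edges of all levels, so one countable set serves every depth and node.\<close>

lemma shannon_packet_hat_eq_majorant:
  assumes "M \<ge> 2" and \<omega>: "\<omega> \<notin> edge_points M"
  shows "shannon_packet_hat M j n \<omega> = packet_majorant M j n \<omega>"
proof -
  have "real M powr (real j / 2) = sqrt (real M) ^ j"
    using assms(1) by (simp add: powr_half_sqrt[symmetric] powr_realpow[symmetric] powr_powr)
  moreover have "(\<Prod>l=1..j. shannon_filter M (node_digit M j n l) (real (M ^ (l - 1)) * \<omega>)) =
      (\<Prod>l<j. shannon_filter M (node_digit M j n (Suc l)) (real (M ^ l) * \<omega>))"
    by (rule prod.reindex_bij_witness[of _ Suc "\<lambda>l. l - 1"]) auto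
  moreover have "shannon_filter M (node_digit M j n (Suc l)) (real (M ^ l) * \<omega>) =
      folded_filter M (node_digit M j n (Suc l)) (real (M ^ l) * \<omega>)" for l
  proof (rule shannon_filter_eq_folded)
    show "real (M ^ l) * \<omega> \<notin> range (\<lambda>i. pi + 2 * pi * real_of_int i)"
    proof
      assume "real (M ^ l) * \<omega> \<in> range (\<lambda>i. pi + 2 * pi * real_of_int i)"
      then obtain i where "real (M ^ l) * \<omega> = pi + 2 * pi * real_of_int i" by blast
      then have "\<omega> = (pi + 2 * pi * real_of_int i) / real (M ^ l)"
        using assms(1) by (simp add: field_simps)
      with \<omega> show False unfolding edge_points_def by blast
    qed
  qed (use node_digit_less assms in auto)
  ultimately show ?thesis
    by (simp add: shannon_packet_hat_def packet_majorant_def folded_product_def)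
qed

section \<open>Null sets and reflection in R^N\<close>

lemma product_sigma_finite_lborel: "product_sigma_finite (\<lambda>_::nat. lborel :: real measure)"
  by unfold_locales

text \<open>Integrate over coordinate r first: with the others fixed, the form is a non-constant
  affine function of that coordinate, so it meets D only on a countable, hence null, set.\<close>

lemma AE_linear_form_notin_countable:
  fixes a :: "nat \<Rightarrow> real"
  assumes D: "countable D" and r: "r \<in> {1..N}" "a r \<noteq> 0"
  shows "AE \<omega> in RN N. (\<Sum>q=1..N. a q * \<omega> q) \<notin> D"
proof -
  interpret product_sigma_finite "\<lambda>_::nat. lborel :: real measure"
    by (rule product_sigma_finite_lborel)
  define I where "I = {1..N} - {r}"
  have I: "{1..N} = insert r I" "finite I" "r \<notin> I"
    using r by (auto simp: I_def)
  have [measurable]: "D \<in> sets borel"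
    by (rule sets.countable[OF _ D]) simp
  let ?f = "\<lambda>\<omega>. indicator D (\<Sum>q=1..N. a q * \<omega> q) :: ennreal"
  have m: "?f \<in> borel_measurable (RN N)" by measurable
  have inner: "(\<integral>\<^sup>+y. ?f (fun_upd \<omega> r y) \<partial>lborel) = 0" for \<omega>
  proof -
    define b where "b = (\<Sum>q\<in>I. a q * \<omega> q)"
    have s: "(\<Sum>q=1..N. a q * (fun_upd \<omega> r y) q) = a r * y + b" for y
      unfolding b_def I(1) using I(2,3) by (subst sum.insert) (auto intro!: sum.cong)
    have "countable ((\<lambda>d. (d - b) / a r) ` D)" using D by simp
    then have "AE y in lborel. y \<notin> (\<lambda>d. (d - b) / a r) ` D"
      by (intro AE_not_in countable_imp_null_set_lborel)
    then have "AE y in lborel. ?f (fun_upd \<omega> r y) = 0"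
    proof eventually_elim
      case (elim y)
      have "a r * y + b \<notin> D"
      proof
        assume "a r * y + b \<in> D"
        moreover have "y = ((a r * y + b) - b) / a r" using r by simp
        ultimately show False using elim by blast
      qed
      then show ?case by (simp only: s) simp
    qed
    then show ?thesis by (simp cong: nn_integral_cong_AE)
  qed
  have "(\<integral>\<^sup>+\<omega>. ?f \<omega> \<partial>RN N) = 0"
    using product_nn_integral_insert[OF I(2,3), of ?f] m inner by (simp add: I(1)[symmetric])
  then have "AE \<omega> in RN N. ?f \<omega> = 0"
    by (simp only: nn_integral_0_iff_AE[OF m])
  then show ?thesis by (auto simp: indicator_def split: if_splits)
qed

text \<open>Transfers the essential bound on the polyspectrum to its reflection. It suffices to
  compare boxes, where one-dimensional symmetry applies in each factor.\<close>

lemma distr_RN_uminus: "distr (RN N) (RN N) (\<lambda>\<omega>. \<lambda>q\<in>{1..N}. - \<omega> q) = RN N"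
proof -
  interpret product_sigma_finite "\<lambda>_::nat. lborel :: real measure"
    by (rule product_sigma_finite_lborel)
  have [measurable]: "(\<lambda>\<omega>. \<lambda>q\<in>{1..N}. - \<omega> q) \<in> measurable (RN N) (RN N)"
    by measurable
  show ?thesis
  proof (rule PiM_eqI)
    fix A :: "nat \<Rightarrow> real set"
    assume "\<And>i. i \<in> {1..N} \<Longrightarrow> A i \<in> sets lborel"
    then have A: "A i \<in> sets borel" if "i \<in> {1..N}" for i using that by simp
    have uA: "uminus -` A i \<in> sets borel" if "i \<in> {1..N}" for i
      using measurable_sets[OF borel_measurable_uminus[OF measurable_ident] A[OF that]] by simp
    have "emeasure (distr (RN N) (RN N) (\<lambda>\<omega>. \<lambda>q\<in>{1..N}. - \<omega> q)) (Pi\<^sub>E {1..N} A) =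
        emeasure (RN N) ((\<lambda>\<omega>. \<lambda>q\<in>{1..N}. - \<omega> q) -` Pi\<^sub>E {1..N} A \<inter> space (RN N))"
      using A by (intro emeasure_distr) (auto intro!: sets_PiM_I_finite)
    also have "(\<lambda>\<omega>. \<lambda>q\<in>{1..N}. - \<omega> q) -` Pi\<^sub>E {1..N} A \<inter> space (RN N) =
        Pi\<^sub>E {1..N} (\<lambda>i. uminus -` A i)"
      by (auto simp: space_PiM PiE_iff)
    also have "emeasure (RN N) \<dots> = (\<Prod>i\<in>{1..N}. emeasure lborel (uminus -` A i))"
      using uA by (intro emeasure_PiM) auto
    also have "\<dots> = (\<Prod>i\<in>{1..N}. emeasure lborel (A i))"
    proof (rule prod.cong[OF refl])
      fix i assume i: "i \<in> {1..N}"
      have "emeasure lborel (A i) = emeasure (distr lborel borel uminus) (A i)"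
        by (simp add: lborel_distr_uminus)
      also have "\<dots> = emeasure lborel (uminus -` A i)"
        using A[OF i] by (subst emeasure_distr) auto
      finally show "emeasure lborel (uminus -` A i) = emeasure lborel (A i)" ..
    qed
    finally show "emeasure (distr (RN N) (RN N) (\<lambda>\<omega>. \<lambda>q\<in>{1..N}. - \<omega> q)) (Pi\<^sub>E {1..N} A) =
        (\<Prod>i\<in>{1..N}. emeasure lborel (A i))" .
  qed simp_all
qed

lemma AE_RN_uminus:
  assumes "AE \<omega> in RN N. Q \<omega>"
  shows "AE \<omega> in RN N. Q (\<lambda>q\<in>{1..N}. - \<omega> q)"
proof (rule AE_distrD[where P = Q])
  show "(\<lambda>\<omega>. \<lambda>q\<in>{1..N}. - \<omega> q) \<in> measurable (RN N) (RN N)" by measurable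
  show "AE \<omega> in distr (RN N) (RN N) (\<lambda>\<omega>. \<lambda>q\<in>{1..N}. - \<omega> q). Q \<omega>"
    using assms by (simp only: distr_RN_uminus)
qed

section \<open>Bounding the cumulant integral and passing to the limit\<close>

text \<open>A non-integrable f has integral 0 by convention, so the bound then holds
  trivially.\<close>

lemma norm_integral_le_of_nn_integral:
  fixes f :: "'a \<Rightarrow> complex"
  assumes "(\<integral>\<^sup>+x. ennreal (norm (f x)) \<partial>M) \<le> ennreal B" "0 \<le> B"
  shows "norm (LINT x|M. f x) \<le> B"
proof (cases "integrable M f")
  case True
  then have "ennreal (norm (LINT x|M. f x)) \<le> ennreal B"
    using integral_norm_bound_ennreal assms(1) order_trans by blast
  with assms(2) show ?thesis by (simp add: ennreal_le_iff)
next
  case False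
  with assms(2) show ?thesis by (simp add: not_integrable_integral_eq)
qed

lemma shannon_cumulant_integral_bound:
  assumes "M \<ge> 2" "N \<ge> 1" "C \<ge> 0"
    and g: "AE \<omega> in RN N. norm (g \<omega>) \<le> C"
  shows "norm (shannon_cumulant_integral M j n N g k)
      \<le> C * sqrt (real M) ^ j * (1 / sqrt (real M) ^ j) ^ N"
proof -
  interpret product_sigma_finite "\<lambda>_::nat. lborel :: real measure"
    by (rule product_sigma_finite_lborel)
  let ?s = "sqrt (real M) ^ j" and ?K = "packet_majorant M j n"
  have s: "?s > 0" using assms(1) by simp
  define F where "F \<omega> = exp (- \<i> * complex_of_real (real (M ^ j) * (\<Sum>q=1..N. real_of_int (k q) * \<omega> q))) *
        g (\<lambda>q\<in>{1..N}. - \<omega> q) *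
        complex_of_real (shannon_packet_hat M j n (- (\<Sum>q=1..N. \<omega> q))) *
        complex_of_real (\<Prod>q=1..N. shannon_packet_hat M j n (\<omega> q))" for \<omega>
  \<comment> \<open>The form with all coefficients -1, with coordinate 1 as pivot; the single
    coordinates below use unit vectors instead.\<close>
  have sum_AE: "AE \<omega> in RN N. - (\<Sum>q=1..N. \<omega> q) \<notin> edge_points M"
    using AE_linear_form_notin_countable[OF countable_edge_points, of 1 N "\<lambda>_. - 1" M] assms(2)
    by (simp add: sum_negf)
  have "AE \<omega> in RN N. \<omega> r \<notin> edge_points M" if "r \<in> {1..N}" for r
    using AE_linear_form_notin_countable[OF countable_edge_points that, of "\<lambda>q. if q = r then 1 else 0" M] that
    by (simp add: if_distrib[of "\<lambda>c. c * _"] cong: if_cong)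
  then have coord_AE: "AE \<omega> in RN N. \<forall>r\<in>{1..N}. \<omega> r \<notin> edge_points M"
    by (subst AE_ball_countable) auto
  have F_le: "AE \<omega> in RN N. ennreal (norm (F \<omega>)) \<le> ennreal (C * ?s) * (\<Prod>q\<in>{1..N}. ennreal (?K (\<omega> q)))"
    using AE_RN_uminus[OF g] sum_AE coord_AE
  proof eventually_elim
    case (elim \<omega>)
    \<comment> \<open>The lags occur only in an exponential of modulus 1, which disappears here;
      this gives uniformity in k.\<close>
    have "norm (F \<omega>) = norm (g (\<lambda>q\<in>{1..N}. - \<omega> q)) * ?K (- (\<Sum>q=1..N. \<omega> q)) * (\<Prod>q\<in>{1..N}. ?K (\<omega> q))"
      using elim(2,3) assms(1)
      by (simp add: F_def norm_mult norm_exp_eq_Re shannon_packet_hat_eq_majorant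
          packet_majorant_bounds prod_nonneg del: of_real_sum of_real_prod of_real_mult)
    also have "\<dots> \<le> C * ?s * (\<Prod>q\<in>{1..N}. ?K (\<omega> q))"
      using elim(1) assms(3)
      by (intro mult_right_mono mult_mono prod_nonneg) (auto simp: packet_majorant_bounds)
    finally have "ennreal (norm (F \<omega>)) \<le> ennreal (C * ?s * (\<Prod>q\<in>{1..N}. ?K (\<omega> q)))"
      by (rule ennreal_leI)
    also have "\<dots> = ennreal (C * ?s) * (\<Prod>q\<in>{1..N}. ennreal (?K (\<omega> q)))"
      using assms(3) by (simp add: ennreal_mult prod_nonneg packet_majorant_bounds prod_ennreal)
    finally show ?case .
  qed
  have "(\<integral>\<^sup>+\<omega>. ennreal (norm (F \<omega>)) \<partial>RN N)
      \<le> (\<integral>\<^sup>+\<omega>. ennreal (C * ?s) * (\<Prod>q\<in>{1..N}. ennreal (?K (\<omega> q))) \<partial>RN N)"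
    using F_le by (rule nn_integral_mono_AE)
  also have "\<dots> = ennreal (C * ?s) * (\<integral>\<^sup>+\<omega>. (\<Prod>q\<in>{1..N}. ennreal (?K (\<omega> q))) \<partial>RN N)"
    by (rule nn_integral_cmult) measurable
  also have "(\<integral>\<^sup>+\<omega>. (\<Prod>q\<in>{1..N}. ennreal (?K (\<omega> q))) \<partial>RN N) =
      (\<Prod>q\<in>{1..N}. \<integral>\<^sup>+x. ennreal (?K x) \<partial>lborel)"
    by (rule product_nn_integral_prod) auto
  also have "ennreal (C * ?s) * \<dots> \<le> ennreal (C * ?s) * (\<Prod>q\<in>{1..N}. ennreal (2 * pi / ?s))"
    by (intro mult_left_mono prod_mono_ennreal nn_integral_packet_majorant assms(1)) auto
  also have "\<dots> = ennreal (C * ?s * (2 * pi / ?s) ^ N)"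
    using assms(3) s by (simp add: ennreal_mult ennreal_power)
  finally have "norm (LINT \<omega>|RN N. F \<omega>) \<le> C * ?s * (2 * pi / ?s) ^ N"
    using assms(3) s by (intro norm_integral_le_of_nn_integral) auto
  \<comment> \<open>The N factors 2 pi from the L1 norms cancel against the normalisation of the
    integral.\<close>
  then have "norm (shannon_cumulant_integral M j n N g k) \<le> C * ?s * (2 * pi / ?s) ^ N / (2 * pi) ^ N"
    unfolding shannon_cumulant_integral_def F_def[symmetric]
    by (simp add: norm_mult norm_divide norm_power divide_right_mono)
  also have "\<dots> = C * ?s * (1 / ?s) ^ N"
    by (simp add: power_divide)
  finally show ?thesis .
qed

theorem theorem3:
  fixes M N :: nat
    and P :: "'a measure"
    and X :: "real \<Rightarrow> 'a \<Rightarrow> real"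
    and \<gamma> :: "nat \<Rightarrow> (nat \<Rightarrow> real) \<Rightarrow> complex"
    and n :: "nat \<Rightarrow> nat"
    and W :: "nat \<Rightarrow> real \<Rightarrow> real"
    and c :: "nat \<Rightarrow> int \<Rightarrow> 'a \<Rightarrow> real"
    and k\<^sub>0 :: int
  assumes "M \<ge> 2"
    and "prob_space P"
    and "strictly_stationary P X"
    and centred: "\<And>t. (LINT x|P. X t x) = 0"
    and second_order: "\<And>t. integrable P (\<lambda>x. (X t x)\<^sup>2)"
    and "qm_continuous P X"
    and finite_moments: "\<And>t p. integrable P (\<lambda>x. X t x ^ p)"
    and polyspectra: "\<And>r. r \<ge> 1 \<Longrightarrow> is_polyspectrum P X r (\<gamma> r)"
    and bounded: "\<And>r. r \<ge> 1 \<Longrightarrow> L_infty r (\<gamma> r)"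
    and band_limited: "AE \<omega> in RN 1. \<omega> 1 \<notin> {- pi..pi} \<longrightarrow> \<gamma> 1 \<omega> = 0"
    and nodes: "\<And>j. n j < M ^ j"
    and packets: "\<And>j. is_shannon_packet M j (n j) (W j)"
    and coeffs: "\<And>j. are_packet_coeffs P X M j (W j) (c j)"
    and cumulant_formula: "\<And>j k\<^sub>0 k. complex_of_real (lag_cumulant P (c j) N k\<^sub>0 k) =
          shannon_cumulant_integral M j (n j) N (\<gamma> N) k"
    and "N > 1"
  shows "uniform_limit ({1..N} \<rightarrow>\<^sub>E (UNIV :: int set))
           (\<lambda>j k. lag_cumulant P (c j) N k\<^sub>0 k) (\<lambda>_. 0) sequentially"
proof -
  let ?s = "sqrt (real M)"
  obtain C\<^sub>0 where "AE \<omega> in RN N. norm (\<gamma> N \<omega>) \<le> C\<^sub>0"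
    using bounded[of N] \<open>N > 1\<close> by (auto simp: L_infty_def)
  then have C: "AE \<omega> in RN N. norm (\<gamma> N \<omega>) \<le> max C\<^sub>0 0" (is "AE \<omega> in _. _ \<le> ?C")
    by eventually_elim simp
  have s: "?s > 1" using \<open>M \<ge> 2\<close> by simp
  have bound: "norm (lag_cumulant P (c j) N k\<^sub>0 k) \<le> ?C * (1 / ?s) ^ j" for j k
  proof -
    let ?t = "(1 / ?s) ^ j"
    have t: "0 < ?t" "?t \<le> 1" "?s ^ j * ?t = 1"
      using s by (auto simp: power_le_one power_divide)
    have "norm (lag_cumulant P (c j) N k\<^sub>0 k) =
        norm (shannon_cumulant_integral M j (n j) N (\<gamma> N) k)"
      unfolding cumulant_formula[of j k\<^sub>0 k, symmetric] by simp
    also have "\<dots> \<le> ?C * ?s ^ j * ?t ^ N"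
      using shannon_cumulant_integral_bound[OF \<open>M \<ge> 2\<close> _ _ C] \<open>N > 1\<close> by (simp add: power_divide)
    \<comment> \<open>Here N > 1 enters: one factor \<open>?t\<close> cancels \<open>?s ^ j\<close>,
      and a second one is left to give the decay M^(-j/2).\<close>
    also have "\<dots> \<le> ?C * ?s ^ j * ?t ^ 2"
      using t(1,2) \<open>N > 1\<close> s by (intro mult_left_mono power_decreasing) auto
    also have "\<dots> = ?C * ?t"
      using t(3) by (simp add: power2_eq_square)
    finally show ?thesis .
  qed
  have "(\<lambda>j. ?C * (1 / ?s) ^ j) \<longlonglongrightarrow> ?C * 0"
    using s by (intro tendsto_mult tendsto_const LIMSEQ_power_zero) simp
  then have lim: "(\<lambda>j. ?C * (1 / ?s) ^ j) \<longlonglongrightarrow> 0" by simp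
  show ?thesis
  proof (rule uniform_limitI)
    fix e :: real assume "e > 0"
    with lim have "\<forall>\<^sub>F j in sequentially. ?C * (1 / ?s) ^ j < e"
      by (rule order_tendstoD)
    then show "\<forall>\<^sub>F j in sequentially. \<forall>k\<in>{1..N} \<rightarrow>\<^sub>E UNIV.
        dist (lag_cumulant P (c j) N k\<^sub>0 k) 0 < e"
      by eventually_elim (use bound in \<open>auto simp: dist_norm intro: order_le_less_trans\<close>)
  qed
qed

end
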